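(* For $m\in\{4,5\}$, the $m$-bonacci word is $c$-balanced with $c=3$, and this bound cannot be improved (i.e. the word is not $2$-balanced). For $m\in\{6,7,\ldots,12\}$, the $m$-bonacci word is $c$-balanced for $c=\left\lceil\frac{m+1}{2}\right\rceil$.
   Context: For $m\ge 2$ and the alphabet $\mathcal{A}=\{0,1,\ldots,m-1\}$, the $m$-bonacci word $\mathbf{u}$ is the unique infinite word over $\mathcal{A}$ that is a fixed point of the substitution (monoid morphism) $\varphi$ given by $0\mapsto 01,\ 1\mapsto 02,\ \ldots,\ (m-2)\mapsto 0(m-1),\ (m-1)\mapsto 0$. A factor of an infinite word $\mathbf{u}=\mathbf{u}_0\mathbf{u}_1\mathbf{u}_2\cdots$ is any finite word $\mathbf{u}_i\mathbf{u}_{i+1}\cdots\mathbf{u}_{i+n-1}$; $|w|$ is the length of $w$ and $|w|_a$ is the number of occurrences of the letter $a$ in $w$. For a positive integer $c$, an infinite word over $\mathcal{A}$ is $c$-balanced if $|w|_a-|v|_a\le c$ for all factors $w,v$ of it of the same length and for every letter $a\in\mathcal{A}$. *)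

theory Defs
  imports Complex_Main "HOL-Library.Stream" "HOL-Library.Sublist"
begin

text \<open>Infinite words are streams, finite words are lists, and the alphabet is \<open>{..<m}\<close>.\<close>

text \<open>Image of a letter under the substitution. For \<open>k \<ge> m\<close>, outside the alphabet, the value
  is junk; it is non-empty so that \<^const>\<open>flat\<close> is well-behaved on every stream.\<close>

definition subst_letter :: "nat \<Rightarrow> nat \<Rightarrow> nat list" where
  "subst_letter m k = (if k + 1 < m then [0, k + 1] else [0])"

definition subst_word :: "nat \<Rightarrow> nat list \<Rightarrow> nat list" where
  "subst_word m w = concat (map (subst_letter m) w)"

definition subst_inf :: "nat \<Rightarrow> nat stream \<Rightarrow> nat stream" where
  "subst_inf m u = flat (smap (subst_letter m) u)"

definition mbonacci_word :: "nat \<Rightarrow> nat stream" where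
  "mbonacci_word m = (THE u. sset u \<subseteq> {..<m} \<and> subst_inf m u = u)"

definition is_factor :: "'a list \<Rightarrow> 'a stream \<Rightarrow> bool" where
  "is_factor w u \<longleftrightarrow> (\<exists>i n. w = stake n (sdrop i u))"

definition balanced :: "'a set \<Rightarrow> nat \<Rightarrow> 'a stream \<Rightarrow> bool" where
  "balanced A c u \<longleftrightarrow>
     (\<forall>w v. is_factor w u \<longrightarrow> is_factor v u \<longrightarrow> length w = length v \<longrightarrow>
        (\<forall>a\<in>A. int (count_list w a) - int (count_list v a) \<le> int c))"

text \<open>Existence and uniqueness of the fixed point, so that the description in
  \<open>mbonacci_word\<close> is meaningful for every \<open>m \<ge> 2\<close>.\<close>

lemma subst_word_append: "subst_word m (v @ w) = subst_word m v @ subst_word m w"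
  by (simp add: subst_word_def)

lemma subst_inf_shift: "subst_inf m (w @- u) = subst_word m w @- subst_inf m u"
  by (induction w) (auto simp: subst_inf_def subst_word_def subst_letter_def)

lemma length_subst_word: "length w \<le> length (subst_word m w)"
  by (induction w) (auto simp: subst_word_def subst_letter_def)

abbreviation iter_word :: "nat \<Rightarrow> nat \<Rightarrow> nat list" where
  "iter_word m n \<equiv> (subst_word m ^^ n) [0]"

lemma hd_iter_word: "\<exists>w. iter_word m n = 0 # w"
proof (induction n)
  case (Suc n)
  then obtain w where "iter_word m n = 0 # w" by blast
  then have "iter_word m (Suc n) = subst_word m (0 # w)" by simp
  also have "\<exists>w'. \<dots> = 0 # w'" by (simp add: subst_word_def subst_letter_def)
  finally show ?case .
qed auto

lemma length_iter_word: "2 \<le> m \<Longrightarrow> n < length (iter_word m n)"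
proof (induction n)
  case (Suc n)
  obtain w where w: "iter_word m n = 0 # w" using hd_iter_word by blast
  then have "iter_word m (Suc n) = subst_letter m 0 @ subst_word m w"
    by (simp add: subst_word_def)
  moreover have "length (subst_letter m 0) = 2"
    using Suc.prems by (simp add: subst_letter_def)
  ultimately have "length (iter_word m (Suc n)) = 2 + length (subst_word m w)"
    by (metis length_append)
  moreover have "length (iter_word m n) = Suc (length w)"
    unfolding w by simp
  ultimately show ?case
    using Suc.IH[OF Suc.prems] length_subst_word[of w m] by linarith
qed auto

lemma prefix_iter_word_Suc: "prefix (iter_word m n) (iter_word m (Suc n))"
proof (induction n)
  case 0
  show ?case by (auto simp: subst_word_def subst_letter_def)
next
  case (Suc n)
  then show ?case by (auto simp: prefix_def subst_word_append)
qed

lemma prefix_iter_word: "n \<le> k \<Longrightarrow> prefix (iter_word m n) (iter_word m k)"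
  by (induction k rule: dec_induct)
     (use prefix_iter_word_Suc prefix_order.order_trans in blast)+

lemma set_iter_word: "2 \<le> m \<Longrightarrow> set (iter_word m n) \<subseteq> {..<m}"
proof (induction n)
  case (Suc n)
  then show ?case by (auto simp: subst_word_def subst_letter_def split: if_splits)
qed auto

lemma subst_fixed_point_prefix:
  assumes "subst_inf m u = u"
  shows "\<exists>v. u = iter_word m n @- v"
proof (induction n)
  case 0
  have "shd (subst_inf m u) = 0"
    by (simp add: subst_inf_def subst_letter_def)
  then have "u = iter_word m 0 @- stl u"
    unfolding assms by (cases u) simp
  then show ?case by blast
next
  case (Suc n)
  then obtain v where "u = iter_word m n @- v" by blast
  then have "subst_inf m u = iter_word m (Suc n) @- subst_inf m v"
    by (simp add: subst_inf_shift)
  then show ?case unfolding assms by blast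
qed

lemma stream_eq_of_prefixes:
  assumes "2 \<le> m"
    and "\<And>n. \<exists>v. u = iter_word m n @- v" "\<And>n. \<exists>v. u' = iter_word m n @- v"
  shows "u = u'"
proof -
  have "u !! n = u' !! n" for n
  proof -
    obtain v v' where "u = iter_word m n @- v" "u' = iter_word m n @- v'"
      using assms(2,3) by metis
    then show ?thesis using length_iter_word[OF assms(1), of n] by simp
  qed
  then have "(!!) u = (!!) u'" by blast
  then show ?thesis using stream_smap_nats[of u] stream_smap_nats[of u'] by simp
qed

theorem mbonacci_ex1:
  assumes m: "2 \<le> m"
  shows "\<exists>!u. sset u \<subseteq> {..<m} \<and> subst_inf m u = u"
proof (rule ex_ex1I)
  define u where "u = smap (\<lambda>i. iter_word m i ! i) nats"
  have nth: "u !! i = iter_word m n ! i" if i: "i < length (iter_word m n)" for i n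
  proof -
    have "prefix (iter_word m n) (iter_word m i) \<or> prefix (iter_word m i) (iter_word m n)"
      using prefix_iter_word by (metis nat_le_linear)
    then have "iter_word m i ! i = iter_word m n ! i"
      using i length_iter_word[OF m, of i] by (auto simp: prefix_def nth_append)
    then show ?thesis by (simp add: u_def)
  qed
  have pre: "\<exists>v. u = iter_word m n @- v" for n
  proof -
    have "stake (length (iter_word m n)) u = iter_word m n"
      by (rule nth_equalityI) (auto simp: nth)
    then have "u = iter_word m n @- sdrop (length (iter_word m n)) u"
      using stake_sdrop[of "length (iter_word m n)" u] by simp
    then show ?thesis by blast
  qed
  have pre': "\<exists>v. subst_inf m u = iter_word m n @- v" for n
  proof (cases n)
    case 0
    have "shd (subst_inf m u) = 0"
      by (simp add: subst_inf_def subst_letter_def)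
    then have "subst_inf m u = iter_word m n @- stl (subst_inf m u)"
      unfolding 0 by (cases "subst_inf m u") simp
    then show ?thesis by blast
  next
    case (Suc k)
    obtain v where "u = iter_word m k @- v" using pre by blast
    then have "subst_inf m u = iter_word m n @- subst_inf m v"
      unfolding Suc by (simp add: subst_inf_shift)
    then show ?thesis by blast
  qed
  have "iter_word m i ! i \<in> {..<m}" for i
    using set_iter_word[OF m] nth_mem[OF length_iter_word[OF m]] by blast
  then have "sset u \<subseteq> {..<m}"
    unfolding u_def stream.set_map by blast
  moreover have "subst_inf m u = u"
    using stream_eq_of_prefixes[OF m pre' pre] .
  ultimately show "\<exists>u. sset u \<subseteq> {..<m} \<and> subst_inf m u = u" by blast
next
  show "u = u'" if "sset u \<subseteq> {..<m} \<and> subst_inf m u = u"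
    "sset u' \<subseteq> {..<m} \<and> subst_inf m u' = u'" for u u'
    by (rule stream_eq_of_prefixes[OF m]; rule subst_fixed_point_prefix; use that in blast)
qed

end

theory Submission
  imports Defs
begin

text \<open>Let \<open>z\<close> be the root in \<open>(0, 1)\<close> of \<open>z + z\<^sup>2 + \<dots> + z\<^sup>m = 1\<close>. The letter \<open>a\<close> has frequency \<open>z\<^bsup>a+1\<^esup>\<close>, so
the natural quantity is the discrepancy \<open>D\<^sub>a(N)\<close>, the number of letters \<open>a\<close> among the first \<open>N\<close>
letters minus \<open>z\<^bsup>a+1\<^esup> N\<close>. For two factors of equal length the frequency terms cancel, and the
difference of the numbers of \<open>a\<close> is a combination of four discrepancies. It is therefore enough
that all values \<open>D\<^sub>a(N)\<close> lie in an interval of length less than \<open>(c + 1) / 2\<close>.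

Every prefix is \<open>\<phi>(p)\<close> or \<open>\<phi>(p) 0\<close> for a prefix \<open>p\<close> (\<open>prefix_desubstitution\<close>). After \<open>K\<close> such steps
\<open>D\<^sub>a(N) = \<Sum>\<^bsub>k<K\<^esub> d\<^sub>k x\<^sub>k + L(p)\<close>, where \<open>d\<^sub>k \<in> {0, 1}\<close>, \<open>x\<^sub>k\<close> is the discrepancy of \<open>\<phi>\<^sup>k(0)\<close> and
\<open>L\<close> is a linear functional of the letter counts of \<open>p\<close>. This functional vanishes on the vector of
frequencies, so \<open>L(p)\<close> is also a linear combination of the discrepancies of the shorter prefix \<open>p\<close>.
Its coefficients become small as \<open>K\<close> grows, because the substitution is of Pisot type, and an
induction on the length turns one inequality between finitely many real numbers into a bound
for all prefixes (\<open>balanced_criterion\<close>).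

Every functional that occurs is given by the sums over a window of a sequence satisfying the
\<open>m\<close>-bonacci recurrence, and one desubstitution moves the window by one place
(\<open>weight_subst_word\<close>). The sequences for \<open>D\<^sub>a\<close> involve the irrational number \<open>z\<^bsup>a+1\<^esup>\<close>. Replacing it
by a quotient of two terms of the fundamental \<open>m\<close>-bonacci sequence \<open>U\<close> costs a controlled error,
since \<open>\<bar>U\<^sub>i - z U\<^bsub>i+1\<^esub>\<bar> \<le> 1\<close> (\<open>fundamental_ratio\<close>); what is left are inequalities between integers,
which are verified by computation for each \<open>m\<close> and \<open>a\<close> (\<open>balanced_if_certificate\<close>).

That \<open>m = 4\<close> and \<open>m = 5\<close> do not allow \<open>c = 2\<close> is shown by explicit pairs of factors, thousands of
letters into the word. The counts in their end points are computed from the digits of the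
positions in the numeration system with base \<open>\<bar>\<phi>\<^sup>k(0)\<bar>\<close> (\<open>not_balanced_if_witness\<close>).\<close>

section \<open>Prefixes of the \<open>m\<close>-bonacci word\<close>

lemma mbonacci_word_fixed_point:
  assumes "2 \<le> m"
  shows "sset (mbonacci_word m) \<subseteq> {..<m}" "subst_inf m (mbonacci_word m) = mbonacci_word m"
  using theI'[OF mbonacci_ex1[OF assms]] unfolding mbonacci_word_def by blast+

lemma set_stake_mbonacci_word:
  assumes "2 \<le> m"
  shows "set (stake n (mbonacci_word m)) \<subseteq> {..<m}"
proof -
  have "set (stake n u) \<subseteq> sset u" for u :: "nat stream"
    by (induction n arbitrary: u) (auto intro: shd_sset stl_sset)
  then show ?thesis using mbonacci_word_fixed_point(1)[OF assms] by blast
qed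

lemma mbonacci_word_split:
  assumes "2 \<le> m"
  shows "\<exists>v. mbonacci_word m = subst_word m (stake n (mbonacci_word m)) @- (0 ## v)"
proof -
  let ?u = "mbonacci_word m"
  have "?u = subst_inf m (stake n ?u @- sdrop n ?u)"
    by (simp add: stake_sdrop mbonacci_word_fixed_point(2)[OF assms])
  also have "\<dots> = subst_word m (stake n ?u) @- subst_inf m (sdrop n ?u)"
    by (rule subst_inf_shift)
  moreover have "shd (subst_inf m (sdrop n ?u)) = 0"
    by (simp add: subst_inf_def subst_letter_def)
  ultimately show ?thesis by (metis stream.collapse)
qed

lemma stake_length_subst_word:
  assumes "2 \<le> m"
  defines "w n \<equiv> subst_word m (stake n (mbonacci_word m))"
  shows "stake (length (w n)) (mbonacci_word m) = w n"
    and "stake (Suc (length (w n))) (mbonacci_word m) = w n @ [0]"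
proof -
  obtain v where v: "mbonacci_word m = w n @- (0 ## v)"
    using mbonacci_word_split[OF assms(1)] unfolding w_def by blast
  show "stake (length (w n)) (mbonacci_word m) = w n"
    by (subst v) (simp add: stake_shift)
  show "stake (Suc (length (w n))) (mbonacci_word m) = w n @ [0]"
    by (subst v) (simp add: stake_shift del: stake.simps(2), simp)
qed

text \<open>Extending a prefix by one letter either completes the image of a letter or opens the next one,
which always starts with \<open>0\<close>; the induction on \<open>N\<close> follows this alternation. The strict decrease
holds because the first image \<open>\<phi>(0)\<close> has two letters, and it is what makes induction on the length
possible for discrepancies.\<close>

lemma prefix_desubstitution:
  assumes m: "2 \<le> m"
  shows "\<exists>N' d. N' \<le> N \<and> (0 < N \<longrightarrow> N' < N) \<and>
    stake N (mbonacci_word m) =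
      subst_word m (stake N' (mbonacci_word m)) @ (if d then [0] else [])"
proof (induction N)
  case 0
  show ?case by (rule exI[of _ 0], rule exI[of _ False]) (simp add: subst_word_def)
next
  case (Suc N)
  let ?u = "mbonacci_word m" and ?w = "\<lambda>n. subst_word m (stake n (mbonacci_word m))"
  note pre = stake_length_subst_word[OF m]
  obtain N' d where N': "N' \<le> N" "0 < N \<longrightarrow> N' < N" "stake N ?u = ?w N' @ (if d then [0] else [])"
    using Suc by blast
  have len: "N = length (?w N') + (if d then 1 else 0)"
    using arg_cong[OF N'(3), of length] by simp
  have step: "?w (Suc N') = ?w N' @ subst_letter m (?u !! N')"
    by (simp only: stake_Suc subst_word_append) (simp add: subst_word_def)
  consider "\<not> d" | "d" "?u !! N' + 1 < m" | "d" "\<not> ?u !! N' + 1 < m" by blast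
  then show ?case
  proof cases
    case 1
    then have "stake (Suc N) ?u = ?w N' @ [0]" using len pre(2)[of N'] by simp
    then show ?thesis using N'(1) by (intro exI[of _ N'] exI[of _ True]) simp
  next
    case 2
    then have "Suc N = length (?w (Suc N'))" unfolding step using len by (simp add: subst_letter_def)
    then have "stake (Suc N) ?u = ?w (Suc N')" using pre(1)[of "Suc N'"] by simp
    then show ?thesis using N'(2) len 2 by (intro exI[of _ "Suc N'"] exI[of _ False]) simp
  next
    case 3
    then have "N = length (?w (Suc N'))" unfolding step using len by (simp add: subst_letter_def)
    then have "stake (Suc N) ?u = ?w (Suc N') @ [0]" using pre(2)[of "Suc N'"] by simp
    then show ?thesis using N'(2) len 3 by (intro exI[of _ "Suc N'"] exI[of _ True]) simp
  qed
qed

section \<open>Linear functionals and \<open>m\<close>-bonacci sequences\<close>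

definition mbonacci_seq :: "nat \<Rightarrow> (nat \<Rightarrow> 'a::comm_ring_1) \<Rightarrow> bool" where
  "mbonacci_seq m h \<longleftrightarrow> (\<forall>k. h (k + m) = (\<Sum>j=k..<k+m. h j))"

text \<open>A sequence \<open>h\<close> encodes the functional that gives the letter \<open>b\<close> the sum of the last \<open>m - b\<close> terms of
the window \<open>{k..<k + m}\<close>. With this encoding the transposed incidence matrix of the substitution
acts by moving the window.\<close>

definition weight :: "nat \<Rightarrow> (nat \<Rightarrow> 'a::comm_ring_1) \<Rightarrow> nat \<Rightarrow> nat \<Rightarrow> 'a" where
  "weight m h k b = (\<Sum>j=k+b..<k+m. h j)"

lemma weight_0: "mbonacci_seq m h \<Longrightarrow> weight m h k 0 = h (k + m)"
  by (simp add: weight_def mbonacci_seq_def)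

lemma weight_Suc:
  assumes "mbonacci_seq m h" "b < m"
  shows "weight m h (Suc k) b = h (k + m) + weight m h k (Suc b)"
  using assms(2) by (simp add: weight_def add.commute)

text \<open>The letter \<open>b\<close> becomes \<open>0 (b + 1)\<close>, which weighs \<open>h (k + m)\<close> plus the sum over \<open>{k + b + 1..<k + m}\<close>:
together the sum over \<open>{k + 1 + b..<k + 1 + m}\<close>. The last letter, whose image is just \<open>0\<close>, fits this
pattern with an empty second sum.\<close>

lemma weight_subst_word:
  assumes h: "mbonacci_seq m h" and "set w \<subseteq> {..<m}"
  shows "sum_list (map (weight m h k) (subst_word m w)) = sum_list (map (weight m h (Suc k)) w)"
  using assms(2)
proof (induction w)
  case Nil
  show ?case by (simp add: subst_word_def)
next
  case (Cons b w)
  have "weight m h k (Suc b) = 0" if "\<not> Suc b < m"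
    using that by (simp add: weight_def)
  then have "sum_list (map (weight m h k) (subst_letter m b)) = weight m h (Suc k) b"
    using Cons.prems by (auto simp: subst_letter_def weight_0[OF h] weight_Suc[OF h])
  then show ?case using Cons by (simp add: subst_word_def)
qed

text \<open>Step \<open>k\<close> of the desubstitution contributes \<open>h (k + m)\<close> or nothing, that is \<open>h (k + m) / 2\<close> up to an
error of half the absolute value. Centring the contributions in this way gives half of the error
that a bound by \<open>\<bar>h (k + m)\<bar>\<close> would give.\<close>

lemma weight_stake_expansion:
  fixes h :: "nat \<Rightarrow> real"
  assumes m: "2 \<le> m" and h: "mbonacci_seq m h"
  shows "\<exists>N'\<le>N. (0 < K \<longrightarrow> 0 < N \<longrightarrow> N' < N) \<and>
    \<bar>sum_list (map (weight m h 0) (stake N (mbonacci_word m)))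
      - sum_list (map (weight m h K) (stake N' (mbonacci_word m)))
      - (\<Sum>k<K. h (k + m)) / 2\<bar> \<le> (\<Sum>k<K. \<bar>h (k + m)\<bar>) / 2"
proof (induction K)
  case 0
  show ?case by (intro exI[of _ N]) simp
next
  case (Suc K)
  let ?u = "mbonacci_word m"
  obtain N' where N': "N' \<le> N" "0 < K \<longrightarrow> 0 < N \<longrightarrow> N' < N"
    "\<bar>sum_list (map (weight m h 0) (stake N ?u)) - sum_list (map (weight m h K) (stake N' ?u))
      - (\<Sum>k<K. h (k + m)) / 2\<bar> \<le> (\<Sum>k<K. \<bar>h (k + m)\<bar>) / 2"
    using Suc by blast
  obtain N'' d where N'': "N'' \<le> N'" "0 < N' \<longrightarrow> N'' < N'"
    "stake N' ?u = subst_word m (stake N'' ?u) @ (if d then [0] else [])"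
    using prefix_desubstitution[OF m] by blast
  have "sum_list (map (weight m h K) (stake N' ?u)) =
      sum_list (map (weight m h (Suc K)) (stake N'' ?u)) + (if d then h (K + m) else 0)"
    unfolding N''(3)
    by (simp add: weight_subst_word[OF h set_stake_mbonacci_word[OF m]] weight_0[OF h])
  then have "\<bar>sum_list (map (weight m h 0) (stake N ?u))
      - sum_list (map (weight m h (Suc K)) (stake N'' ?u))
      - (\<Sum>k<Suc K. h (k + m)) / 2\<bar> \<le> (\<Sum>k<Suc K. \<bar>h (k + m)\<bar>) / 2"
    using N'(3) by (auto simp: add_divide_distrib abs_if split: if_splits)
  moreover have "N'' \<le> N" "0 < N \<longrightarrow> N'' < N"
    using N'(1,2) N''(1,2) by auto
  ultimately show ?case by blast
qed

section \<open>Letter frequencies and discrepancy\<close>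

lemma ex_frequency_root:
  assumes "2 \<le> m"
  shows "\<exists>z::real. 0 < z \<and> z < 1 \<and> (\<Sum>b<m. z ^ Suc b) = 1"
proof -
  let ?f = "\<lambda>z::real. \<Sum>b<m. z ^ Suc b"
  have "\<exists>z\<ge>0. z \<le> 1 \<and> ?f z = 1"
    by (rule IVT') (use assms in \<open>auto intro!: continuous_intros\<close>)
  then obtain z where z: "0 \<le> z" "z \<le> 1" "?f z = 1" by blast
  moreover have "z \<noteq> 0" using z(3) by auto
  moreover have "z \<noteq> 1" using z(3) assms by auto
  ultimately show ?thesis by (intro exI[of _ z]) simp
qed

locale mbonacci_root =
  fixes m :: nat and z :: real
  assumes m: "2 \<le> m" and z_pos: "0 < z" and z_less_1: "z < 1"
    and z_sum: "(\<Sum>b<m. z ^ Suc b) = 1"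
begin

definition discrepancy :: "nat \<Rightarrow> nat \<Rightarrow> real" where
  "discrepancy a N = real (count_list (stake N (mbonacci_word m)) a) - z ^ Suc a * real N"

text \<open>This form of the equation for \<open>z\<close> matches the two-term form \<open>h (k + m + 1) = 2 h (k + m) - h k\<close> of the
\<open>m\<close>-bonacci recurrence.\<close>

lemma two_z: "2 * z = 1 + z ^ Suc m"
proof -
  have "(\<Sum>b<Suc m. z ^ Suc b) = z + z * (\<Sum>b<m. z ^ Suc b)"
    by (subst sum.lessThan_Suc_shift) (simp add: sum_distrib_left)
  then show ?thesis using z_sum by simp
qed

text \<open>The vector \<open>(z, z\<^sup>2, \<dots>, z\<^sup>m)\<close> is an eigenvector of the incidence matrix for the eigenvalue \<open>1 / z\<close>, so a
functional that vanishes on it still does after composition with the substitution.\<close>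

lemma weight_orthogonal:
  assumes h: "mbonacci_seq m h" and "(\<Sum>b<m. z ^ Suc b * weight m h 0 b) = 0"
  shows "(\<Sum>b<m. z ^ Suc b * weight m h k b) = 0"
proof (induction k)
  case (Suc k)
  have m0: "weight m h k m = 0" by (simp add: weight_def)
  have "(\<Sum>b<Suc m. z ^ Suc b * weight m h k b) =
      z * (h (k + m) + (\<Sum>b<m. z ^ Suc b * weight m h k (Suc b)))"
    by (subst sum.lessThan_Suc_shift)
      (simp add: weight_0[OF h] sum_distrib_left algebra_simps)
  then have "h (k + m) + (\<Sum>b<m. z ^ Suc b * weight m h k (Suc b)) = 0"
    using Suc m0 z_pos by simp
  moreover have "(\<Sum>b<m. z ^ Suc b * weight m h (Suc k) b) =
      (\<Sum>b<m. z ^ Suc b) * h (k + m) + (\<Sum>b<m. z ^ Suc b * weight m h k (Suc b))"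
    by (simp add: weight_Suc[OF h] distrib_left sum.distrib sum_distrib_right)
  ultimately show ?case using z_sum by simp
qed (use assms in simp)

text \<open>A functional that vanishes on the frequencies cannot see the part of the letter counts that is
proportional to the length; counts may then be replaced by discrepancies.\<close>

lemma weight_stake_discrepancy:
  assumes "mbonacci_seq m h" "(\<Sum>b<m. z ^ Suc b * weight m h 0 b) = 0"
  shows "sum_list (map (weight m h k) (stake N (mbonacci_word m))) =
    (\<Sum>b<m. weight m h k b * discrepancy b N)"
proof -
  let ?w = "stake N (mbonacci_word m)"
  have "sum_list (map f w) = (\<Sum>b<m. real (count_list w b) * f b)"
    if "set w \<subseteq> {..<m}" for f :: "nat \<Rightarrow> real" and w
    using that
  proof (induction w)
    case (Cons c w)
    then have "(\<Sum>b<m. real (count_list (c # w) b) * f b) =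
        (\<Sum>b<m. real (count_list w b) * f b + (if b = c then f b else 0))"
      by (intro sum.cong) (auto simp: algebra_simps)
    then show ?case using Cons by (simp add: sum.distrib)
  qed simp
  from this[OF set_stake_mbonacci_word[OF m]]
  have "sum_list (map (weight m h k) ?w) = (\<Sum>b<m. real (count_list ?w b) * weight m h k b)" .
  also have "\<dots> = (\<Sum>b<m. weight m h k b * discrepancy b N)
      + real N * (\<Sum>b<m. z ^ Suc b * weight m h k b)"
    unfolding discrepancy_def sum_distrib_left sum.distrib[symmetric]
    by (rule sum.cong) (auto simp: algebra_simps)
  finally show ?thesis using weight_orthogonal[OF assms] by simp
qed

text \<open>The hypothesis says \<open>2 S + 4 B t < 2 B\<close> with \<open>B = (c + 1) / 2\<close>, where \<open>S\<close> is the total contribution of the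
\<open>K\<close> desubstitution steps and \<open>t\<close> the norm of the remaining functional. It is used twice. First,
\<open>S + t B \<le> B\<close> propagates the crude bound \<open>\<bar>discrepancy a N\<bar> \<le> B\<close> from shorter prefixes to longer ones.
Then every discrepancy lies within \<open>r = S / 2 + t B\<close> of a fixed centre, and the difference of two
counts, being made of four discrepancies, is at most \<open>4 r < c + 1\<close>; it is an integer, hence at most
\<open>c\<close>.\<close>

theorem balanced_criterion:
  fixes h :: "nat \<Rightarrow> nat \<Rightarrow> real" and c K :: nat
  assumes h: "\<And>a. a < m \<Longrightarrow> mbonacci_seq m (h a)"
    and h0: "\<And>a b. a < m \<Longrightarrow> b < m \<Longrightarrow> weight m (h a) 0 b = (if b = a then 1 else 0) - z ^ Suc a"
    and K: "0 < K"
    and bound: "\<And>a. a < m \<Longrightarrow> 2 * (\<Sum>k<K. \<bar>h a (k + m)\<bar>)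
      + 2 * (real c + 1) * (\<Sum>b<m. \<bar>weight m (h a) K b\<bar>) < real c + 1"
  shows "balanced {..<m} c (mbonacci_word m)"
proof -
  let ?u = "mbonacci_word m" and ?B = "(real c + 1) / 2"
  let ?S = "\<lambda>a. \<Sum>k<K. \<bar>h a (k + m)\<bar>" and ?c = "\<lambda>a. (\<Sum>k<K. h a (k + m)) / 2"
    and ?t = "\<lambda>a. \<Sum>b<m. \<bar>weight m (h a) K b\<bar>"
  have orth: "(\<Sum>b<m. z ^ Suc b * weight m (h a) 0 b) = 0" if a: "a < m" for a
  proof -
    have "(\<Sum>b<m. z ^ Suc b * weight m (h a) 0 b) =
        (\<Sum>b<m. (if b = a then z ^ Suc b else 0) - z ^ Suc b * z ^ Suc a)"
      by (rule sum.cong) (auto simp: h0[OF a] algebra_simps)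
    also have "\<dots> = z ^ Suc a - (\<Sum>b<m. z ^ Suc b) * z ^ Suc a"
      using a by (simp add: sum_subtractf sum_distrib_right)
    finally show ?thesis using z_sum by simp
  qed
  have D0: "sum_list (map (weight m (h a) 0) (stake N ?u)) = discrepancy a N" if a: "a < m" for a N
  proof -
    have "sum_list (map (weight m (h a) 0) w) = real (count_list w a) - z ^ Suc a * length w"
      if "set w \<subseteq> {..<m}" for w
      using that by (induction w) (auto simp: h0[OF a] algebra_simps)
    from this[OF set_stake_mbonacci_word[OF m]] show ?thesis by (simp add: discrepancy_def)
  qed
  have step: "\<exists>N'. (0 < N \<longrightarrow> N' < N) \<and>
      \<bar>discrepancy a N - ?c a - (\<Sum>b<m. weight m (h a) K b * discrepancy b N')\<bar> \<le> ?S a / 2"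
    if a: "a < m" for a N
  proof -
    obtain N' where N': "0 < K \<longrightarrow> 0 < N \<longrightarrow> N' < N"
      "\<bar>discrepancy a N - (\<Sum>b<m. weight m (h a) K b * discrepancy b N') - ?c a\<bar> \<le> ?S a / 2"
      using weight_stake_expansion[OF m h[OF a], of N K]
      unfolding D0[OF a] weight_stake_discrepancy[OF h[OF a] orth[OF a], where k = K]
      by (elim exE conjE) (rule that)
    then have "\<bar>discrepancy a N - ?c a - (\<Sum>b<m. weight m (h a) K b * discrepancy b N')\<bar> \<le> ?S a / 2"
      by linarith
    then show ?thesis using N'(1) K by (intro exI[of _ N'] conjI) simp_all
  qed
  have tail: "\<bar>\<Sum>b<m. weight m (h a) K b * discrepancy b N'\<bar> \<le> ?t a * ?B"
    if "\<And>b. b < m \<Longrightarrow> \<bar>discrepancy b N'\<bar> \<le> ?B" for a N'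
  proof -
    have "\<bar>\<Sum>b<m. weight m (h a) K b * discrepancy b N'\<bar>
        \<le> (\<Sum>b<m. \<bar>weight m (h a) K b * discrepancy b N'\<bar>)" by (rule sum_abs)
    also have "\<dots> \<le> (\<Sum>b<m. \<bar>weight m (h a) K b\<bar> * ?B)"
      by (rule sum_mono) (simp only: abs_mult, rule mult_left_mono, use that in auto)
    finally show ?thesis by (simp only: sum_distrib_right)
  qed
  have c_le: "\<bar>?c a\<bar> \<le> ?S a / 2" for a
    using sum_abs[of "\<lambda>k. h a (k + m)" "{..<K}"] by simp
  have t0: "0 \<le> ?t a * ?B" for a by (intro mult_nonneg_nonneg sum_nonneg) auto
  have bound': "?S a + 2 * (?t a * ?B) < ?B" if "a < m" for a
    using bound[OF that] by (simp add: field_simps)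
  have D: "\<bar>discrepancy a N\<bar> \<le> ?B" if "a < m" for a N
    using that
  proof (induction N arbitrary: a rule: less_induct)
    case (less N)
    show ?case
    proof (cases "N = 0")
      case True
      then show ?thesis by (simp add: discrepancy_def)
    next
      case False
      obtain N' where N': "0 < N \<longrightarrow> N' < N"
        "\<bar>discrepancy a N - ?c a - (\<Sum>b<m. weight m (h a) K b * discrepancy b N')\<bar> \<le> ?S a / 2"
        using step[OF less.prems, of N] by (elim exE conjE) (rule that)
      have "N' < N" using N'(1) False by simp
      have "\<bar>\<Sum>b<m. weight m (h a) K b * discrepancy b N'\<bar> \<le> ?t a * ?B"
        by (rule tail, rule less.IH[OF \<open>N' < N\<close>])
      then show ?thesis
        using N'(2) c_le[of a] bound'[OF less.prems] t0[of a] by linarith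
    qed
  qed
  have D': "\<bar>discrepancy a N - ?c a\<bar> \<le> ?S a / 2 + ?t a * ?B" if a: "a < m" for a N
  proof -
    obtain N' where N':
      "\<bar>discrepancy a N - ?c a - (\<Sum>b<m. weight m (h a) K b * discrepancy b N')\<bar> \<le> ?S a / 2"
      using step[OF a, of N] by (elim exE conjE) (rule that)
    have "\<bar>\<Sum>b<m. weight m (h a) K b * discrepancy b N'\<bar> \<le> ?t a * ?B"
      by (rule tail, rule D)
    then show ?thesis using N' by linarith
  qed
  have count: "real (count_list (stake n (sdrop i ?u)) a) =
      discrepancy a (i + n) - discrepancy a i + z ^ Suc a * real n" for a i n
  proof -
    have "count_list (stake (i + n) ?u) a =
        count_list (stake i ?u) a + count_list (stake n (sdrop i ?u)) a"
      by (simp only: stake_add[symmetric] count_list_append)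
    then show ?thesis unfolding discrepancy_def by (simp only: of_nat_add distrib_left)
  qed
  show ?thesis
    unfolding balanced_def is_factor_def
  proof (intro allI impI ballI, elim exE)
    fix w v a i j n n'
    assume wv: "length w = length v" "w = stake n (sdrop i ?u)" "v = stake n' (sdrop j ?u)"
      and "a \<in> {..<m}"
    then have "n' = n" and a: "a < m" by auto
    define r where "r = ?S a / 2 + ?t a * ?B"
    have r: "4 * r < real c + 1"
    proof -
      have "4 * (s / 2 + t) < y" if "s + 2 * t < y / 2" for s t y :: real
        using that by (simp add: field_simps)
      then show ?thesis unfolding r_def using bound'[OF a] .
    qed
    have "\<bar>discrepancy a N - ?c a\<bar> \<le> r" for N
      unfolding r_def by (rule D'[OF a])
    then have range: "discrepancy a N \<le> ?c a + r" "?c a - r \<le> discrepancy a N" for N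
      unfolding abs_le_iff by (simp_all add: algebra_simps)
    have "real (count_list w a) - real (count_list v a) < real c + 1"
      unfolding wv(2,3) \<open>n' = n\<close> count
      using r range(1)[of "i + n"] range(2)[of i] range(2)[of "j + n"] range(1)[of j] by linarith
    then show "int (count_list w a) - int (count_list v a) \<le> int c" by linarith
  qed
qed

end

section \<open>Integer sequences and rational approximation of the frequencies\<close>

lemma mbonacci_seq_double:
  assumes "mbonacci_seq m h" "0 < m"
  shows "h (Suc (k + m)) = 2 * h (k + m) - h k"
proof -
  have "h k + (\<Sum>j=Suc k..<Suc k + m. h j) = (\<Sum>j=k..<Suc (k + m). h j)"
    using sum.atLeast_Suc_lessThan[of k "Suc (k + m)" h] by simp
  also have "\<dots> = 2 * h (k + m)"
    using assms(1) by (simp add: mbonacci_seq_def)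
  also have "(\<Sum>j=Suc k..<Suc k + m. h j) = h (Suc k + m)"
    using assms(1) unfolding mbonacci_seq_def by metis
  finally show ?thesis by (metis add_Suc add_diff_cancel_left')
qed

lemma mbonacci_seq_shift: "mbonacci_seq m h \<Longrightarrow> mbonacci_seq m (\<lambda>i. h (i + s))"
  unfolding mbonacci_seq_def sum.shift_bounds_nat_ivl[symmetric]
  by (simp only: add.assoc add.commute[of m s]) (simp only: add.assoc[symmetric], simp)

lemma mbonacci_seq_diff:
  "mbonacci_seq m g \<Longrightarrow> mbonacci_seq m h \<Longrightarrow> mbonacci_seq m (\<lambda>i. x * g i - y * h i)"
  by (simp add: mbonacci_seq_def sum_subtractf sum_distrib_left)

lemma mbonacci_seq_of_int:
  "mbonacci_seq m h \<Longrightarrow> mbonacci_seq m (\<lambda>i. real_of_int (h i))"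
  by (simp add: mbonacci_seq_def)

fun mbonacci_extend :: "nat \<Rightarrow> (nat \<Rightarrow> int) \<Rightarrow> nat \<Rightarrow> int" where
  "mbonacci_extend m f i = (if i < m then f i else (\<Sum>j\<in>{i-m..<i}. mbonacci_extend m f j))"

declare mbonacci_extend.simps [simp del]

lemma mbonacci_extend_init: "i < m \<Longrightarrow> mbonacci_extend m f i = f i"
  by (simp add: mbonacci_extend.simps)

lemma mbonacci_seq_extend: "mbonacci_seq m (mbonacci_extend m f)"
  unfolding mbonacci_seq_def by (subst mbonacci_extend.simps) simp

text \<open>The value at \<open>k + m\<close> is the length of \<open>\<phi>\<^sup>k(0)\<close>: the initial values give every letter the weight \<open>1\<close>.\<close>

definition fundamental :: "nat \<Rightarrow> nat \<Rightarrow> int" where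
  "fundamental m = mbonacci_extend m (\<lambda>i. if Suc i = m then 1 else 0)"

text \<open>The initial values give the letter \<open>a\<close> the weight \<open>1\<close> and all others the weight \<open>0\<close>, so the value at
\<open>k + m\<close> is the number of letters \<open>a\<close> in \<open>\<phi>\<^sup>k(0)\<close>.\<close>

definition letter_seq :: "nat \<Rightarrow> nat \<Rightarrow> nat \<Rightarrow> int" where
  "letter_seq m a = mbonacci_extend m (\<lambda>i. (if i = a then 1 else 0) - (if Suc i = a then 1 else 0))"

lemma mbonacci_seq_fundamental: "mbonacci_seq m (fundamental m)"
  by (simp add: fundamental_def mbonacci_seq_extend)

lemma mbonacci_seq_letter_seq: "mbonacci_seq m (letter_seq m a)"
  by (simp add: letter_seq_def mbonacci_seq_extend)

lemma fundamental_init: "i < m \<Longrightarrow> fundamental m i = (if Suc i = m then 1 else 0)"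
  by (simp add: fundamental_def mbonacci_extend_init)

lemma weight_fundamental: "b < m \<Longrightarrow> weight m (fundamental m) 0 b = 1"
proof -
  assume b: "b < m"
  have "weight m (fundamental m) 0 b = (\<Sum>j=b..<m. if j = m - 1 then 1 else 0)"
    unfolding weight_def by (rule sum.cong) (auto simp: fundamental_init)
  then show ?thesis using b by simp
qed

lemma weight_letter_seq:
  assumes "a < m" "b \<le> m"
  shows "weight m (letter_seq m a) 0 b = (if b = a then 1 else 0)"
proof -
  have "weight m (letter_seq m a) 0 b =
      (\<Sum>j=b..<m. if j = a then 1 else 0) - (\<Sum>j=b..<m. if Suc j = a then 1 else 0)"
    unfolding weight_def sum_subtractf[symmetric]
    by (rule sum.cong) (auto simp: letter_seq_def mbonacci_extend_init)
  moreover have "(\<Sum>j=b..<m. if Suc j = a then 1 else 0) = (if b < a then 1 else (0::int))"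
    using assms by (cases a) auto
  ultimately show ?thesis using assms by auto
qed

lemma fundamental_nonneg: "0 \<le> fundamental m i"
proof (induction i rule: less_induct)
  case (less i)
  then show ?case
    unfolding fundamental_def by (subst mbonacci_extend.simps) (auto intro!: sum_nonneg)
qed

lemma fundamental_at_m: "0 < m \<Longrightarrow> fundamental m m = 1"
  using weight_0[OF mbonacci_seq_fundamental, of m 0] weight_fundamental[of 0 m] by simp

lemma fundamental_le_power: 
  assumes "0 < m"
  shows "fundamental m i \<le> 2 ^ i"
proof (induction i)
  case 0
  show ?case using assms by (simp add: fundamental_init)
next
  case (Suc i)
  have one: "(1::int) \<le> 2 ^ Suc i" by (rule one_le_power) simp
  consider "Suc i < m" | "Suc i = m" | "m \<le> i" by linarith
  then show ?case
  proof cases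
    case 3
    then obtain k where k: "i = k + m" by (metis add.commute le_add_diff_inverse)
    have "fundamental m (Suc i) = 2 * fundamental m i - fundamental m k"
      unfolding k by (rule mbonacci_seq_double[OF mbonacci_seq_fundamental assms])
    then show ?thesis using Suc fundamental_nonneg[of m k] by simp
  qed (use one assms in \<open>auto simp: fundamental_init fundamental_at_m\<close>)
qed

context mbonacci_root
begin

text \<open>The differences \<open>e\<^sub>i = U\<^sub>i - z U\<^bsub>i+1\<^esub>\<close> satisfy \<open>e\<^bsub>k+m\<^esub> = \<Sum>\<^bsub>j<m\<^esub> z\<^bsup>j+1\<^esup> e\<^bsub>k+j\<^esub>\<close>. The coefficients are positive and sum up to
\<open>1\<close>, so each term is a weighted mean of the \<open>m\<close> previous ones and the bound for the first \<open>m\<close> terms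
persists. The averaging recurrence comes from dividing the characteristic polynomial of the
\<open>m\<close>-bonacci recurrence by \<open>x - 1 / z\<close> and multiplying the quotient by \<open>x - 1\<close>.\<close>

lemma fundamental_ratio: "\<bar>fundamental m i - z * fundamental m (Suc i)\<bar> \<le> 1"
proof -
  define e where "e i = 1 * real_of_int (fundamental m i) - z * fundamental m (i + 1)" for i
  note U = mbonacci_seq_of_int[OF mbonacci_seq_fundamental]
  have e: "mbonacci_seq m e"
    unfolding e_def by (rule mbonacci_seq_diff[OF U mbonacci_seq_shift[OF U]])
  have double: "e (Suc (k + m)) = 2 * e (k + m) - e k" for k
    using mbonacci_seq_double[OF e] m by simp
  obtain p where p: "m = Suc (Suc p)" using m by (metis add_2_eq_Suc le_Suc_ex)
  \<comment> \<open>With \<open>p = m - 2\<close> the last two of the first \<open>m\<close> terms are the only nonzero ones.\<close>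
  have init: "e i = (if i = p then - z else if i = Suc p then 1 - z else 0)" if "i < m" for i
    using that p fundamental_at_m[of m] by (auto simp: e_def fundamental_init)
  have e_m: "e m = 1 - 2 * z"
    using mbonacci_seq_double[OF mbonacci_seq_fundamental, of m 0] fundamental_at_m[of m] p
    by (simp add: e_def fundamental_init)
  have convex: "e (k + m) = (\<Sum>j<m. z ^ Suc j * e (k + j))" for k
  proof (induction k)
    case 0
    have "(\<Sum>j<m. z ^ Suc j * e j) = (\<Sum>j<p. z ^ Suc j * e j) + z ^ Suc p * e p + z ^ m * e (Suc p)"
      by (simp add: p)
    also have "(\<Sum>j<p. z ^ Suc j * e j) = 0"
      by (rule sum.neutral) (auto simp: init p)
    finally have "(\<Sum>j<m. z ^ Suc j * e j) = z ^ Suc p * e p + z ^ m * e (Suc p)"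
      by (simp only: add_0)
    also have "\<dots> = - (z ^ Suc m)"
    proof -
      have e: "e p = - z" "e (Suc p) = 1 - z" using init p by auto
      show ?thesis unfolding e by (simp add: p algebra_simps)
    qed
    finally show ?case using e_m two_z by (simp del: power_Suc)
  next
    case (Suc k)
    have "(\<Sum>j<Suc m. z ^ Suc j * e (k + j)) = z * (e k + (\<Sum>j<m. z ^ Suc j * e (Suc k + j)))"
      by (subst sum.lessThan_Suc_shift) (simp add: sum_distrib_left algebra_simps)
    moreover have "(\<Sum>j<Suc m. z ^ Suc j * e (k + j)) = (2 * z) * e (k + m)"
      by (simp only: sum.lessThan_Suc Suc.IH[symmetric] two_z distrib_right mult_1)
    ultimately have "2 * e (k + m) = e k + (\<Sum>j<m. z ^ Suc j * e (Suc k + j))"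
      using z_pos by simp
    then show ?case using double[of k] by simp
  qed
  have "\<bar>e i\<bar> \<le> 1"
  proof (induction i rule: less_induct)
    case (less i)
    show ?case
    proof (cases "i < m")
      case True
      then show ?thesis using init z_pos z_less_1 by auto
    next
      case False
      then obtain k where k: "i = k + m" by (metis add.commute le_add_diff_inverse not_less)
      have "\<bar>e i\<bar> \<le> (\<Sum>j<m. \<bar>z ^ Suc j * e (k + j)\<bar>)"
        unfolding k convex by (rule sum_abs)
      also have "\<dots> \<le> (\<Sum>j<m. z ^ Suc j)"
      proof (rule sum_mono)
        fix j assume "j \<in> {..<m}"
        then have "\<bar>e (k + j)\<bar> \<le> 1" using less.IH k by simp
        then show "\<bar>z ^ Suc j * e (k + j)\<bar> \<le> z ^ Suc j"
          using z_pos by (simp add: abs_mult mult_left_le)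
      qed
      finally show ?thesis using z_sum by simp
    qed
  qed
  then show ?thesis by (simp add: e_def)
qed

text \<open>Telescoping: the difference is \<open>\<Sum>\<^bsub>t<s\<^esub> z\<^sup>t e\<^bsub>i+t\<^esub>\<close> with \<open>\<bar>e\<^bsub>i+t\<^esub>\<bar> \<le> 1\<close>.\<close>

lemma fundamental_ratio_power: "\<bar>fundamental m i - z ^ s * fundamental m (i + s)\<bar> \<le> s"
proof (induction s)
  case (Suc s)
  have "\<bar>z ^ s * (fundamental m (i + s) - z * fundamental m (Suc (i + s)))\<bar> \<le> 1 * 1"
    unfolding abs_mult using fundamental_ratio[of "i + s"] z_pos z_less_1
    by (intro mult_mono) (auto simp: power_le_one)
  then show ?case using Suc by (simp add: algebra_simps)
qed simp

text \<open>The sequence that encodes the functional whose value on a prefix is its discrepancy.\<close>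

definition disc_seq :: "nat \<Rightarrow> nat \<Rightarrow> real" where
  "disc_seq a i = letter_seq m a i - z ^ Suc a * fundamental m i"

lemma mbonacci_seq_disc_seq: "mbonacci_seq m (disc_seq a)"
  using mbonacci_seq_diff[OF mbonacci_seq_of_int[OF mbonacci_seq_letter_seq]
      mbonacci_seq_of_int[OF mbonacci_seq_fundamental], of m 1 a "z ^ Suc a"]
  by (simp add: disc_seq_def[abs_def])

lemma weight_disc_seq:
  assumes "a < m" "b < m"
  shows "weight m (disc_seq a) 0 b = (if b = a then 1 else 0) - z ^ Suc a"
proof -
  have "weight m (disc_seq a) 0 b = real_of_int (weight m (letter_seq m a) 0 b)
      - z ^ Suc a * real_of_int (weight m (fundamental m) 0 b)"
    by (simp add: weight_def disc_seq_def sum_subtractf sum_distrib_left)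
  then show ?thesis using assms by (simp add: weight_letter_seq weight_fundamental)
qed

text \<open>Replacing \<open>z\<^bsup>a+1\<^esup>\<close> by \<open>p / q\<close> changes the sequence by a multiple of the fundamental one, and
\<open>\<bar>p - z\<^bsup>a+1\<^esup> q\<bar> \<le> a + 1 \<le> m\<close>. Relative to \<open>q\<close> the error is negligible once \<open>n\<close> exceeds the indices \<open>i\<close> in
question by a few dozen.\<close>

lemma disc_seq_approx:
  fixes a n :: nat
  assumes a: "a < m"
  defines "p \<equiv> fundamental m n" and "q \<equiv> fundamental m (n + Suc a)"
  shows "\<bar>q * disc_seq a i - (q * letter_seq m a i - p * fundamental m i)\<bar> \<le> real m * 2 ^ i"
proof -
  have "\<bar>p - z ^ Suc a * q\<bar> \<le> m"
    using fundamental_ratio_power[of n "Suc a"] a unfolding p_def q_def by linarith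
  moreover have "\<bar>real_of_int (fundamental m i)\<bar> \<le> 2 ^ i"
    using fundamental_nonneg[of m i] fundamental_le_power[of m i] m
    by (metis abs_of_nonneg gr0I not_numeral_le_zero of_int_0_le_iff of_int_le_numeral_power_cancel_iff)
  ultimately have "\<bar>(p - z ^ Suc a * q) * fundamental m i\<bar> \<le> real m * 2 ^ i"
    unfolding abs_mult by (intro mult_mono) auto
  then show ?thesis by (simp add: disc_seq_def algebra_simps)
qed

text \<open>The criterion above multiplied by the common denominator \<open>q\<close>. The term with \<open>2 ^ (K + m)\<close> collects
the approximation errors: the errors of the \<open>K\<close> single terms and those of each of the \<open>m\<close> window
sums are bounded by the geometric series \<open>m * (\<Sum>j<K + m. 2 ^ j)\<close>.\<close>

theorem balanced_integer_criterion:
  fixes c K :: nat and n :: "nat \<Rightarrow> nat"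
  assumes K: "0 < K"
    and cert: "\<And>a p q H. a < m \<Longrightarrow> p = fundamental m (n a) \<Longrightarrow> q = fundamental m (n a + Suc a) \<Longrightarrow>
      H = (\<lambda>i. q * letter_seq m a i - p * fundamental m i) \<Longrightarrow>
      2 * (\<Sum>k<K. \<bar>H (k + m)\<bar>) + 2 * (int c + 1) * (\<Sum>b<m. \<bar>weight m H K b\<bar>)
        + 2 * int m * (1 + (int c + 1) * int m) * 2 ^ (K + m) < (int c + 1) * q"
  shows "balanced {..<m} c (mbonacci_word m)"
proof (rule balanced_criterion[OF mbonacci_seq_disc_seq weight_disc_seq K])
  fix a assume a: "a < m"
  define p q where pq: "p = fundamental m (n a)" "q = fundamental m (n a + Suc a)"
  define H where "H = (\<lambda>i. q * letter_seq m a i - p * fundamental m i)"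
  have approx: "\<bar>q * disc_seq a i - H i\<bar> \<le> real m * 2 ^ i" for i
    using disc_seq_approx[OF a, of "n a" i] unfolding H_def pq .
  have pow: "(\<Sum>j=i..<k. (2::real) ^ j) \<le> 2 ^ k" if "i \<le> k" for i k
    using that by (induction k rule: dec_induct) auto
  have q: "0 \<le> q" unfolding pq by (rule fundamental_nonneg)
  have "q * (\<Sum>k<K. \<bar>disc_seq a (k + m)\<bar>) = (\<Sum>k<K. \<bar>q * disc_seq a (k + m)\<bar>)"
    using q by (simp add: sum_distrib_left abs_mult)
  also have "\<dots> \<le> (\<Sum>k<K. \<bar>real_of_int (H (k + m))\<bar> + real m * 2 ^ (k + m))"
  proof (rule sum_mono)
    show "\<bar>q * disc_seq a (k + m)\<bar> \<le> \<bar>real_of_int (H (k + m))\<bar> + real m * 2 ^ (k + m)" for k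
      using approx[of "k + m"] by linarith
  qed
  also have "\<dots> = (\<Sum>k<K. \<bar>H (k + m)\<bar>) + real m * (\<Sum>j=0+m..<K+m. 2 ^ j)"
    unfolding sum.shift_bounds_nat_ivl
    by (simp add: sum.distrib sum_distrib_left lessThan_atLeast0)
  also have "\<dots> \<le> (\<Sum>k<K. \<bar>H (k + m)\<bar>) + real m * 2 ^ (K + m)"
    using pow[of "0 + m" "K + m"] by (intro add_left_mono mult_left_mono) auto
  finally have S: "q * (\<Sum>k<K. \<bar>disc_seq a (k + m)\<bar>) \<le> (\<Sum>k<K. \<bar>H (k + m)\<bar>) + real m * 2 ^ (K + m)" .
  have "\<bar>q * weight m (disc_seq a) K b\<bar> \<le> \<bar>weight m H K b\<bar> + real m * 2 ^ (K + m)" if b: "b < m" for b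
  proof -
    have "q * weight m (disc_seq a) K b - weight m H K b =
        (\<Sum>j=K+b..<K+m. q * disc_seq a j - H j)"
      by (simp add: weight_def sum_subtractf sum_distrib_left)
    also have "\<bar>\<dots>\<bar> \<le> (\<Sum>j=K+b..<K+m. \<bar>q * disc_seq a j - H j\<bar>)" by (rule sum_abs)
    also have "\<dots> \<le> (\<Sum>j=K+b..<K+m. real m * 2 ^ j)" by (rule sum_mono) (rule approx)
    also have "\<dots> \<le> real m * 2 ^ (K + m)"
      unfolding sum_distrib_left[symmetric] using pow[of "K + b" "K + m"] b
      by (intro mult_left_mono) auto
    finally show ?thesis by (simp add: abs_if split: if_splits)
  qed
  then have "(\<Sum>b<m. \<bar>q * weight m (disc_seq a) K b\<bar>)
      \<le> (\<Sum>b<m. \<bar>weight m H K b\<bar> + real m * 2 ^ (K + m))"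
    by (intro sum_mono) simp
  then have t: "q * (\<Sum>b<m. \<bar>weight m (disc_seq a) K b\<bar>)
      \<le> (\<Sum>b<m. \<bar>weight m H K b\<bar>) + real m * (real m * 2 ^ (K + m))"
    using q by (simp add: sum_distrib_left abs_mult sum.distrib)
  let ?S = "\<Sum>k<K. \<bar>disc_seq a (k + m)\<bar>" and ?t = "\<Sum>b<m. \<bar>weight m (disc_seq a) K b\<bar>"
  have "real_of_int (2 * (\<Sum>k<K. \<bar>H (k + m)\<bar>) + 2 * (int c + 1) * (\<Sum>b<m. \<bar>weight m H K b\<bar>)
      + 2 * int m * (1 + (int c + 1) * int m) * 2 ^ (K + m)) < real_of_int ((int c + 1) * q)"
    unfolding of_int_less_iff by (rule cert[OF a pq H_def])
  then have "2 * ((\<Sum>k<K. \<bar>H (k + m)\<bar>) + real m * 2 ^ (K + m))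
      + 2 * (real c + 1) * ((\<Sum>b<m. \<bar>weight m H K b\<bar>) + real m * (real m * 2 ^ (K + m))) < (real c + 1) * q"
    by (simp add: algebra_simps)
  moreover have "2 * (q * ?S) + 2 * (real c + 1) * (q * ?t) \<le>
      2 * ((\<Sum>k<K. \<bar>H (k + m)\<bar>) + real m * 2 ^ (K + m))
      + 2 * (real c + 1) * ((\<Sum>b<m. \<bar>weight m H K b\<bar>) + real m * (real m * 2 ^ (K + m)))"
    using S t by (intro add_mono mult_left_mono) auto
  moreover have "q * (2 * S + 2 * (real c + 1) * t) = 2 * (q * S) + 2 * (real c + 1) * (q * t)"
    for S t :: real
    by (simp add: algebra_simps)
  ultimately have "q * (2 * ?S + 2 * (real c + 1) * ?t) < q * (real c + 1)"
    by (simp only: mult.commute[of _ "real c + 1"])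
  then show "2 * ?S + 2 * (real c + 1) * ?t < real c + 1"
    by (rule mult_left_less_imp_less) (use q in simp)
qed

end

section \<open>Checking the criterion by integer arithmetic\<close>

text \<open>The list holds the values computed so far, latest first, and \<open>s\<close> is the next value. The two-term form
of the recurrence needs one doubling and one subtraction per step.\<close>

fun extend :: "nat \<Rightarrow> nat \<Rightarrow> int \<Rightarrow> int list \<Rightarrow> int list" where
  "extend m 0 s xs = xs"
| "extend m (Suc k) s xs = extend m k (2 * s - xs ! (m - 1)) (s # xs)"

lemma extend_correct:
  assumes h: "mbonacci_seq m h" and m: "0 < m" and "m \<le> N"
  shows "extend m k (h N) (rev (map h [0..<N])) = rev (map h [0..<N + k])"
  using assms(3)
proof (induction k arbitrary: N)
  case (Suc k)
  have "rev (map h [0..<N]) ! (m - 1) = h (N - m)"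
    using Suc.prems m by (simp add: rev_nth)
  moreover have "2 * h N - h (N - m) = h (Suc N)"
    using mbonacci_seq_double[OF h m, of "N - m"] Suc.prems by simp
  ultimately show ?case using Suc.IH[of "Suc N"] Suc.prems by simp
qed simp

fun abs_prefix_sums :: "int \<Rightarrow> int list \<Rightarrow> int" where
  "abs_prefix_sums s [] = 0"
| "abs_prefix_sums s (x # xs) = \<bar>s + x\<bar> + abs_prefix_sums (s + x) xs"

lemma abs_prefix_sums_eq:
  "abs_prefix_sums s xs = (\<Sum>i<length xs. \<bar>s + sum_list (take (Suc i) xs)\<bar>)"
proof (induction xs arbitrary: s)
  case (Cons x xs)
  then show ?case
    unfolding length_Cons by (subst sum.lessThan_Suc_shift) (simp add: add.assoc)
qed simp

definition initial_values :: "nat \<Rightarrow> nat \<Rightarrow> int \<Rightarrow> int \<Rightarrow> int list" where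
  "initial_values m a q p =
    rev (map (\<lambda>i. q * ((if i = a then 1 else 0) - (if Suc i = a then 1 else 0))
      - p * (if Suc i = m then 1 else 0)) [0..<m])"

definition compute_values :: "nat \<Rightarrow> nat \<Rightarrow> int list \<Rightarrow> int list" where
  "compute_values m K xs = extend m K (sum_list xs) xs"

text \<open>The integer inequality, for values listed from the index \<open>K + m - 1\<close> down to \<open>0\<close>. The partial sums of
the first \<open>m\<close> entries are the window sums that make up the remaining functional.\<close>

definition oscillation_bound :: "nat \<Rightarrow> nat \<Rightarrow> nat \<Rightarrow> int \<Rightarrow> int list \<Rightarrow> bool" where
  "oscillation_bound m c K q xs \<longleftrightarrow>
    2 * sum_list (map abs (take K xs)) + 2 * (int c + 1) * abs_prefix_sums 0 (take m xs)
      + 2 * int m * (1 + (int c + 1) * int m) * 2 ^ (K + m) < (int c + 1) * q"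

text \<open>The list \<open>us\<close> holds terms of the fundamental sequence, latest first, so the quotient of entry \<open>a + 1\<close>
and entry \<open>0\<close> approximates \<open>z\<^bsup>a+1\<^esup>\<close>. Each stage of the check is a function of its own, so that rewriting
reduces its arguments to numerals before it unfolds its body.\<close>

definition letter_certificate :: "nat \<Rightarrow> nat \<Rightarrow> nat \<Rightarrow> int list \<Rightarrow> nat \<Rightarrow> bool" where
  "letter_certificate m c K us a \<longleftrightarrow>
    oscillation_bound m c K (hd us) (compute_values m K (initial_values m a (hd us) (us ! Suc a)))"

text \<open>The fundamental sequence is computed \<open>30\<close> places further than the sequences it is used for; this
makes the error term small against \<open>(c + 1) * q\<close>.\<close>

definition certificate :: "nat \<Rightarrow> nat \<Rightarrow> nat \<Rightarrow> bool" where
  "certificate m c K \<longleftrightarrow>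
    list_all (letter_certificate m c K (extend m (K + 30) 1 (1 # replicate (m - 1) 0))) [0..<m]"

lemma sum_list_top_abs:
  "sum_list (map abs (take K (rev (map H [0..<m + K])))) = (\<Sum>k<K. \<bar>H (k + m) :: int\<bar>)"
proof -
  have "sum_list (map abs (take K (rev (map H [0..<m + K])))) = (\<Sum>j=m..<m+K. \<bar>H j\<bar>)"
    by (simp add: take_rev drop_map rev_map[symmetric] comp_def interv_sum_list_conv_sum_set_nat)
  also have "\<dots> = (\<Sum>k<K. \<bar>H (k + m)\<bar>)"
    using sum.shift_bounds_nat_ivl[of "\<lambda>j. \<bar>H j\<bar>" 0 m K] by (simp add: lessThan_atLeast0 add.commute)
  finally show ?thesis .
qed

lemma abs_prefix_sums_top:
  "abs_prefix_sums 0 (take m (rev (map H [0..<m + K]))) = (\<Sum>b<m. \<bar>weight m H K b\<bar>)"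
proof -
  have "sum_list (take (Suc i) (take m (rev (map H [0..<m + K])))) = weight m H K (m - Suc i)"
    if "i < m" for i
  proof -
    have "K + (m - Suc i) = m + K - Suc i" using that by simp
    then show ?thesis
      using that by (simp add: take_rev drop_map interv_sum_list_conv_sum_set_nat weight_def
          add.commute min_def)
  qed
  then have "abs_prefix_sums 0 (take m (rev (map H [0..<m + K])))
      = (\<Sum>i<m. \<bar>weight m H K (m - Suc i)\<bar>)"
    unfolding abs_prefix_sums_eq by (intro sum.cong) simp_all
  then show ?thesis by (simp add: sum.nat_diff_reindex[of "\<lambda>b. \<bar>weight m H K b\<bar>"])
qed

theorem balanced_if_certificate:
  assumes m: "2 \<le> m" and K: "0 < K" and cert: "certificate m c K"
  shows "balanced {..<m} c (mbonacci_word m)"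
proof -
  obtain z where "mbonacci_root m z"
    using ex_frequency_root[OF m] m unfolding mbonacci_root_def by blast
  then interpret mbonacci_root m z .
  let ?N = "m + (K + 30)" and ?U = "fundamental m"
  have m0: "0 < m" using m by simp
  have "rev (map ?U [0..<m]) = 1 # replicate (m - 1) 0"
    by (rule nth_equalityI) (use m0 in \<open>auto simp: rev_nth fundamental_init nth_Cons split: nat.split\<close>)
  then have us: "extend m (K + 30) 1 (1 # replicate (m - 1) 0) = rev (map ?U [0..<?N])"
    using extend_correct[OF mbonacci_seq_fundamental m0 order_refl, of "K + 30"]
    by (simp add: fundamental_at_m[OF m0])
  show ?thesis
  proof (rule balanced_integer_criterion[OF K, where n = "\<lambda>a. ?N - 1 - Suc a"])
    fix a p q H
    assume a: "a < m" and p: "p = ?U (?N - 1 - Suc a)" and q: "q = ?U (?N - 1 - Suc a + Suc a)"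
      and H: "H = (\<lambda>i. q * letter_seq m a i - p * ?U i)"
    have us_q: "hd (rev (map ?U [0..<?N])) = q"
      using a by (simp add: q hd_rev last_map)
    have us_p: "rev (map ?U [0..<?N]) ! Suc a = p"
      using a by (simp add: p rev_nth)
    have H_seq: "mbonacci_seq m H"
      unfolding H by (rule mbonacci_seq_diff[OF mbonacci_seq_letter_seq mbonacci_seq_fundamental])
    have init: "initial_values m a q p = rev (map H [0..<m])"
      unfolding initial_values_def H
      by (simp add: letter_seq_def mbonacci_extend_init fundamental_init cong: if_cong)
    have "sum_list (rev (map H [0..<m])) = H m"
      using weight_0[OF H_seq, of 0]
      by (simp add: weight_def interv_sum_list_conv_sum_set_nat)
    then have xs: "compute_values m K (initial_values m a q p) = rev (map H [0..<m + K])"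
      unfolding compute_values_def init using extend_correct[OF H_seq m0 order_refl] by simp
    have "letter_certificate m c K (rev (map ?U [0..<?N])) a"
      using cert a unfolding certificate_def us list_all_iff by simp
    then show "2 * (\<Sum>k<K. \<bar>H (k + m)\<bar>) + 2 * (int c + 1) * (\<Sum>b<m. \<bar>weight m H K b\<bar>)
        + 2 * int m * (1 + (int c + 1) * int m) * 2 ^ (K + m) < (int c + 1) * q"
      unfolding letter_certificate_def us_q us_p xs oscillation_bound_def sum_list_top_abs
        abs_prefix_sums_top .
  qed
qed

section \<open>Unbalanced pairs of factors\<close>

text \<open>The digits are listed from the least significant one. As every image starts with \<open>0\<close>, appending \<open>0\<close>
to the image of a prefix gives a prefix again, whatever the digits are.\<close>

primrec digit_word :: "nat \<Rightarrow> bool list \<Rightarrow> nat list" where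
  "digit_word m [] = []"
| "digit_word m (d # ds) = subst_word m (digit_word m ds) @ (if d then [0] else [])"

text \<open>One step of the incidence matrix: every letter produces a \<open>0\<close>, and every letter except the last also
its successor.\<close>

primrec digit_counts :: "nat \<Rightarrow> bool list \<Rightarrow> int list" where
  "digit_counts m [] = replicate m 0"
| "digit_counts m (d # ds) =
    (let v = digit_counts m ds in (sum_list v + (if d then 1 else 0)) # butlast v)"

lemma stake_digit_word:
  assumes m: "2 \<le> m"
  shows "stake (length (digit_word m ds)) (mbonacci_word m) = digit_word m ds"
proof (induction ds)
  case (Cons d ds)
  then show ?case using stake_length_subst_word[OF m, of "length (digit_word m ds)"]
    by (cases d) (simp_all del: stake.simps(2))
qed simp

lemma count_list_subst_word:
  assumes "set w \<subseteq> {..<m}" "b < m"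
  shows "count_list (subst_word m w) b = (if b = 0 then length w else count_list w (b - 1))"
  using assms(1)
  by (induction w) (use assms(2) in \<open>auto simp: subst_word_def subst_letter_def\<close>)

lemma digit_counts_eq:
  assumes m: "2 \<le> m"
  shows "digit_counts m ds = map (\<lambda>b. int (count_list (digit_word m ds) b)) [0..<m]"
    and "sum_list (digit_counts m ds) = int (length (digit_word m ds))"
proof -
  have set_word: "set (digit_word m ds) \<subseteq> {..<m}" for ds
    using set_stake_mbonacci_word[OF m] stake_digit_word[OF m] by metis
  have total: "(\<Sum>b\<leftarrow>[0..<m]. int (count_list w b)) = int (length w)" if "set w \<subseteq> {..<m}" for w
  proof -
    have "(\<Sum>b<m. count_list w b) = (\<Sum>b\<in>set w. count_list w b)"
      by (rule sum.mono_neutral_right) (use that in \<open>auto simp: count_list_0_iff\<close>)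
    then show ?thesis
      by (simp add: interv_sum_list_conv_sum_set_nat sum_count_set lessThan_atLeast0
          flip: of_nat_sum)
  qed
  show counts: "digit_counts m ds = map (\<lambda>b. int (count_list (digit_word m ds) b)) [0..<m]"
  proof (induction ds)
    case Nil
    show ?case by (simp add: map_replicate_const)
  next
    case (Cons d ds)
    let ?f = "\<lambda>ds b. int (count_list (digit_word m ds) b)"
    have cons: "map g [0..<m] = g 0 # map (\<lambda>b. g (Suc b)) [0..<m - 1]" for g :: "nat \<Rightarrow> int"
      using map_upt_Suc[of g "m - 1"] m by (simp del: upt_Suc)
    have butlast: "butlast (map g [0..<m]) = map g [0..<m - 1]" for g :: "nat \<Rightarrow> int"
      using m by (cases m) auto
    show ?case
      unfolding digit_counts.simps Let_def Cons total[OF set_word] butlast cons[of "?f (d # ds)"]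
      using m by (auto simp: count_list_subst_word[OF set_word])
  qed
  show "sum_list (digit_counts m ds) = int (length (digit_word m ds))"
    unfolding counts by (rule total[OF set_word])
qed

text \<open>The first pair stands for the end points of a factor with many letters \<open>a\<close>, the second one for those
of a factor of the same length with few.\<close>

definition unbalanced_witness ::
  "nat \<Rightarrow> nat \<Rightarrow> nat \<Rightarrow> bool list \<times> bool list \<Rightarrow> bool list \<times> bool list \<Rightarrow> bool" where
  "unbalanced_witness m c a = (\<lambda>(i, k) (j, l).
    let v = digit_counts m in
      a < m \<and> sum_list (v i) \<le> sum_list (v k) \<and>
      sum_list (v k) - sum_list (v i) = sum_list (v l) - sum_list (v j) \<and>
      int c < v k ! a - v i ! a - (v l ! a - v j ! a))"

lemma not_balanced_if_witness:
  assumes m: "2 \<le> m" and witness: "unbalanced_witness m c a (i, k) (j, l)"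
  shows "\<not> balanced {..<m} c (mbonacci_word m)"
proof
  let ?u = "mbonacci_word m" and ?n = "\<lambda>ds. length (digit_word m ds)"
  assume bal: "balanced {..<m} c ?u"
  have a: "a < m" and len: "?n i \<le> ?n k" "?n j \<le> ?n l" "?n k - ?n i = ?n l - ?n j"
    and c: "int c < int (count_list (digit_word m k) a) - int (count_list (digit_word m i) a)
      - (int (count_list (digit_word m l) a) - int (count_list (digit_word m j) a))"
    using witness
    by (auto simp: unbalanced_witness_def Let_def digit_counts_eq(2)[OF m])
      (auto simp: digit_counts_eq(1)[OF m])
  have count: "int (count_list (stake (?n y - ?n x) (sdrop (?n x) ?u)) a) =
      int (count_list (digit_word m y) a) - int (count_list (digit_word m x) a)"
    if "?n x \<le> ?n y" for x y
  proof -
    have "digit_word m y = stake (?n x + (?n y - ?n x)) ?u"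
      using that stake_digit_word[OF m, of y] by simp
    also have "\<dots> = digit_word m x @ stake (?n y - ?n x) (sdrop (?n x) ?u)"
      by (simp only: stake_add[symmetric] stake_digit_word[OF m])
    finally have "digit_word m y = digit_word m x @ stake (?n y - ?n x) (sdrop (?n x) ?u)" .
    from arg_cong[OF this, of "\<lambda>w. int (count_list w a)"] show ?thesis by simp
  qed
  have factor: "is_factor (stake n (sdrop p ?u)) ?u" for n p
    unfolding is_factor_def by blast
  have "int (count_list (stake (?n k - ?n i) (sdrop (?n i) ?u)) a)
      - int (count_list (stake (?n l - ?n j) (sdrop (?n j) ?u)) a) \<le> int c"
    by (rule bal[unfolded balanced_def, rule_format, OF factor factor]) (use len(3) a in simp_all)
  then show False using c count[OF len(1)] count[OF len(2)] by simp
qed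

section \<open>The values of \<open>m\<close> from 4 to 12\<close>

text \<open>The last argument is close to the least number of desubstitution steps for which the inequality
holds. More steps are needed for larger \<open>m\<close> because the second largest eigenvalue of the substitution
in modulus approaches the unit circle.\<close>

lemma certificates_4_to_10:
  "certificate 4 3 17"
  "certificate 5 3 31"
  "certificate 6 4 31"
  "certificate 7 4 49"
  "certificate 8 5 52"
  "certificate 9 5 76"
  "certificate 10 6 89"
  by code_simp+

lemma certificate_11:
  "certificate 11 6 123"
  by code_simp

lemma certificate_12:
  "certificate 12 7 136"
  by code_simp

text \<open>The factors of length \<open>3305\<close> at the positions \<open>2663\<close> and \<open>9048\<close>.\<close>

lemma unbalanced_witness_4:
  "unbalanced_witness 4 2 1
     (map ((=) (1::nat)) [1, 0, 1, 1, 1, 0, 1, 1, 1, 0, 1, 1],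
      map ((=) (1::nat)) [0, 1, 0, 0, 0, 1, 0, 0, 0, 1, 0, 0, 0, 1])
     (map ((=) (1::nat)) [0, 1, 0, 0, 0, 1, 0, 0, 1, 1, 0, 0, 1, 1],
      map ((=) (1::nat)) [1, 0, 1, 1, 1, 0, 1, 1, 0, 0, 0, 1, 0, 0, 1])"
  by code_simp

text \<open>The factors of length \<open>1037\<close> at the positions \<open>2612\<close> and \<open>6415\<close>.\<close>

lemma unbalanced_witness_5:
  "unbalanced_witness 5 2 2
     (map ((=) (1::nat)) [1, 1, 0, 1, 1, 1, 1, 0, 1, 1, 0, 1],
      map ((=) (1::nat)) [0, 0, 1, 0, 0, 0, 0, 1, 0, 0, 0, 0, 1])
     (map ((=) (1::nat)) [0, 0, 1, 0, 0, 0, 1, 1, 0, 0, 1, 1, 1],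
      map ((=) (1::nat)) [1, 1, 0, 1, 1, 1, 0, 0, 0, 1, 0, 0, 0, 1])"
  by code_simp

theorem theorem3p1:
  shows "(\<forall>m\<in>{4, 5}. balanced {..<m} 3 (mbonacci_word m) \<and>
                       \<not> balanced {..<m} 2 (mbonacci_word m)) \<and>
         (\<forall>m\<in>{6..12}. balanced {..<m} (nat \<lceil>(real m + 1) / 2\<rceil>) (mbonacci_word m))"
proof (intro conjI ballI)
  note bal = certificates_4_to_10[THEN balanced_if_certificate[rotated 2]]
    certificate_11[THEN balanced_if_certificate[rotated 2]]
    certificate_12[THEN balanced_if_certificate[rotated 2]]
  show "balanced {..<m} 3 (mbonacci_word m)" if "m \<in> {4, 5}" for m
    using that bal(1,2) by auto
  show "\<not> balanced {..<m} 2 (mbonacci_word m)" if "m \<in> {4, 5}" for m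
    using that not_balanced_if_witness[OF _ unbalanced_witness_4]
      not_balanced_if_witness[OF _ unbalanced_witness_5] by auto
  fix m :: nat
  assume "m \<in> {6..12}"
  then consider "m = 6" | "m = 7" | "m = 8" | "m = 9" | "m = 10" | "m = 11" | "m = 12"
    by (auto simp: le_Suc_eq numeral_eq_Suc)
  then show "balanced {..<m} (nat \<lceil>(real m + 1) / 2\<rceil>) (mbonacci_word m)"
    by cases (use bal(3-9) in simp_all)
qed

end
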